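(* Let $G$ be an arbitrary Abelian group, and let $n\ge8$ and $k\in[n-1]$ be positive integers. For every polynomial $P$ of degree at most $1$ with coefficients in $G$ that is non-zero at some point of $\{0,1\}^n_k$, \[ \Pr_{\mathbf{x}\sim\{0,1\}^n_k}[P(\mathbf{x})\ne0]\;\ge\;\frac{t-1}{n},\qquad t=\min\{k,n-k\}, \] where $\mathbf{x}$ is uniform on $\{0,1\}^n_k$.
   Context: $\{0,1\}^n_k$ is the set of strings in $\{0,1\}^n$ of Hamming weight $k$. A polynomial of degree at most $1$ over $G$ is $P(\mathbf{x})=a_1x_1+\dots+a_nx_n+c$ with $a_i,c\in G$, evaluated on $0/1$ inputs in the obvious way. *)

theory Defs
  imports "HOL-Probability.Probability"
begin

text \<open>A string of length \<open>n\<close> is a function on the index set \<open>{1..n}\<close>, made extensional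
  so that equal strings are equal functions.\<close>

definition boolean_slice :: "nat \<Rightarrow> nat \<Rightarrow> (nat \<Rightarrow> nat) set" where
  "boolean_slice n k = {x \<in> {1..n} \<rightarrow>\<^sub>E {0, 1}. card {i \<in> {1..n}. x i \<noteq> 0} = k}"

text \<open>The value of \<open>a\<^sub>1x\<^sub>1 + \<dots> + a\<^sub>nx\<^sub>n + c\<close> at a \<open>0/1\<close> input \<open>x\<close>. A group has no
  multiplication, so the product \<open>a\<^sub>ix\<^sub>i\<close> is \<open>a\<^sub>i\<close> when \<open>x\<^sub>i = 1\<close> and \<open>0\<close> when \<open>x\<^sub>i = 0\<close>.\<close>

definition eval_deg1 :: "nat \<Rightarrow> (nat \<Rightarrow> 'g::ab_group_add) \<Rightarrow> 'g \<Rightarrow> (nat \<Rightarrow> nat) \<Rightarrow> 'g" where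
  "eval_deg1 n a c x = (\<Sum>i\<in>{1..n}. if x i = 1 then a i else 0) + c"

end

theory Submission
  imports Defs
begin

text \<open>Identify strings with subsets. If \<open>a i \<noteq> a j\<close>, then among the sets containing exactly one of
  \<open>i\<close>, \<open>j\<close> at least half are non-zeros, by swapping \<open>i\<close> and \<open>j\<close>; so the excess of zeros over
  non-zeros is controlled by the sets that contain both or neither. On the middle layer, iterate this
  over disjoint pairs. Either about \<open>k/2\<close> disjoint pairs exist, and the remaining excess is at most
  a \<open>1/k\<close> fraction of the layer, or all but a few coefficients are equal; in that case stop when one
  exceptional coefficient is left, where the excess is a difference of neighbouring binomial
  coefficients, again a \<open>1/k\<close> fraction at most.

  For \<open>n > 2k\<close> average over the restrictions \<open>x\<^sub>i = 0\<close>: if one of them vanishes identically, then all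
  other coefficients agree and the non-zeros are exactly the sets containing \<open>i\<close>, a \<open>k/n\<close> fraction.
  For \<open>k \<le> 3\<close> a single pair suffices because \<open>n \<ge> 8\<close>, and \<open>k > n/2\<close> is reduced to \<open>k \<le> n/2\<close> by
  taking complements.\<close>

section \<open>Layers of the subset lattice and the excess of zeros over non-zeros\<close>

text \<open>The level is an integer, so that the levels \<open>k - 1\<close> and \<open>k - 2\<close> in the recursions below give
  the empty layer, rather than being truncated to level 0, when they are negative.\<close>

definition layer :: "'i set \<Rightarrow> int \<Rightarrow> 'i set set" where
  "layer I k = {A. A \<subseteq> I \<and> int (card A) = k}"

text \<open>Zeros count 1 and non-zeros -1, so that a zero and a non-zero cancel and an upper bound
  on the excess is a lower bound on the number of non-zeros.\<close>

definition excess :: "('i \<Rightarrow> 'g::ab_group_add) \<Rightarrow> 'g \<Rightarrow> 'i set \<Rightarrow> int \<Rightarrow> real" where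
  "excess a c I k = (\<Sum>A\<in>layer I k. if sum a A + c = 0 then 1 else - 1)"

definition nonzeros :: "('i \<Rightarrow> 'g::ab_group_add) \<Rightarrow> 'g \<Rightarrow> 'i set \<Rightarrow> int \<Rightarrow> 'i set set" where
  "nonzeros a c I k = {A \<in> layer I k. sum a A + c \<noteq> 0}"

lemma finite_layer [simp]: "finite I \<Longrightarrow> finite (layer I k)"
  unfolding layer_def by simp

lemma finite_nonzeros [simp]: "finite I \<Longrightarrow> finite (nonzeros a c I k)"
  unfolding nonzeros_def by simp

lemma layer_neg: "k < 0 \<Longrightarrow> layer I k = {}"
  unfolding layer_def by auto

lemma card_layer: "finite I \<Longrightarrow> card (layer I (int k)) = card I choose k"
  unfolding layer_def using n_subsets[of I k] by simp

text \<open>Pascal's rule at the level of sets: a set either avoids \<open>i\<close> or arises by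
  adding \<open>i\<close> one level down.\<close>

lemma layer_insert:
  assumes "finite I" "i \<notin> I"
  shows "layer (insert i I) k = layer I k \<union> insert i ` layer I (k - 1)"
proof (intro set_eqI iffI)
  fix A assume A: "A \<in> layer (insert i I) k"
  then have fA: "finite A"
    using assms(1) finite_subset[of A "insert i I"] unfolding layer_def by simp
  show "A \<in> layer I k \<union> insert i ` layer I (k - 1)"
  proof (cases "i \<in> A")
    case True
    have "card A = Suc (card (A - {i}))" using card_Suc_Diff1[OF fA True] by simp
    then have "A - {i} \<in> layer I (k - 1)" using A unfolding layer_def by auto
    moreover have "A = insert i (A - {i})" using True by auto
    ultimately show ?thesis by blast
  next
    case False then show ?thesis using A unfolding layer_def by auto
  qed
next
  fix A assume "A \<in> layer I k \<union> insert i ` layer I (k - 1)"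
  then consider "A \<in> layer I k" | B where "A = insert i B" "B \<in> layer I (k - 1)" by auto
  then show "A \<in> layer (insert i I) k"
  proof cases
    case 1 then show ?thesis unfolding layer_def by auto
  next
    case 2
    then have "finite B" "i \<notin> B"
      using assms finite_subset[of B I] unfolding layer_def by auto
    then show ?thesis using 2 unfolding layer_def by auto
  qed
qed

lemma sum_layer_insert:
  assumes "finite I" "i \<notin> I"
  shows "sum f (layer (insert i I) k) = sum f (layer I k) + (\<Sum>A\<in>layer I (k - 1). f (insert i A))"
proof -
  have "i \<notin> A" if "A \<in> layer I (k - 1)" for A
    using that assms unfolding layer_def by auto
  then have inj: "inj_on (insert i) (layer I (k - 1))"
    by (intro inj_onI) (metis insert_ident)
  have disj: "layer I k \<inter> insert i ` layer I (k - 1) = {}"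
    using assms unfolding layer_def by auto
  have "sum f (layer (insert i I) k) = sum f (layer I k) + sum f (insert i ` layer I (k - 1))"
    unfolding layer_insert[OF assms] using assms(1) disj by (intro sum.union_disjoint) auto
  then show ?thesis by (simp add: sum.reindex[OF inj])
qed

lemma in_layerD:
  assumes "A \<in> layer I k" "finite I" shows "A \<subseteq> I" "finite A" "int (card A) = k"
  using assms finite_subset[of A I] unfolding layer_def by auto

text \<open>Fixing whether \<open>i\<close> is a member leaves a polynomial on \<open>I\<close>;
  membership moves \<open>a i\<close> into the constant.\<close>

lemma excess_insert:
  assumes "finite I" "i \<notin> I"
  shows "excess a c (insert i I) k = excess a c I k + excess a (c + a i) I (k - 1)"
proof -
  have "sum a (insert i A) + c = sum a A + (c + a i)" if "A \<in> layer I (k - 1)" for A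
    using in_layerD[OF that assms(1)] assms(2) by (subst sum.insert) (auto simp: algebra_simps)
  then show ?thesis
    unfolding excess_def sum_layer_insert[OF assms] by (intro arg_cong2[where f=plus] sum.cong) (auto simp: ac_simps)
qed

text \<open>No set is a zero for both constants, so each contributes at most 1 - 1 = 0.\<close>

lemma excess_add_le_0:
  assumes "c \<noteq> d" "finite I"
  shows "excess a c I k + excess a d I k \<le> 0"
proof -
  have "\<not> (s + c = 0 \<and> s + d = 0)" for s using assms(1) by (metis add_left_imp_eq)
  then show ?thesis unfolding excess_def sum.distrib[symmetric] by (intro sum_nonpos) auto
qed

text \<open>Sets containing exactly one of \<open>i\<close> and \<open>j\<close> give two
  polynomials on \<open>I\<close> with distinct constants \<open>c + a i\<close> and
  \<open>c + a j\<close>; together they contribute at most 0. Only the sets containing neither or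
  both remain.\<close>

lemma excess_pair_le:
  assumes "finite I" "i \<notin> I" "j \<notin> I" "a i \<noteq> a j"
  shows "excess a c (insert i (insert j I)) k \<le> excess a c I k + excess a (c + a i + a j) I (k - 2)"
proof -
  have ij: "i \<notin> insert j I" using assms by auto
  have "excess a c (insert i (insert j I)) k
      = excess a c I k + excess a (c + a j) I (k - 1) + (excess a (c + a i) I (k - 1) + excess a (c + a i + a j) I (k - 1 - 1))"
    using assms ij by (simp add: excess_insert)
  moreover have "excess a (c + a j) I (k - 1) + excess a (c + a i) I (k - 1) \<le> 0"
    using assms by (intro excess_add_le_0) auto
  ultimately show ?thesis by simp
qed

lemma excess_le_card: "finite I \<Longrightarrow> excess a c I k \<le> card (layer I k)"
  unfolding excess_def by (rule order_trans[OF sum_bounded_above[where K=1]]) auto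

section \<open>Stripping disjoint pairs with distinct coefficients\<close>

text \<open>\<open>strip a r I J\<close> says that removing \<open>r\<close> disjoint pairs, each
  with two distinct coefficients, leads from \<open>I\<close> to \<open>J\<close>. The outermost
  pair is the first one removed, which matches the recursion of
  \<open>excess_pair_le\<close>.\<close>

inductive strip :: "('i \<Rightarrow> 'g) \<Rightarrow> nat \<Rightarrow> 'i set \<Rightarrow> 'i set \<Rightarrow> bool" for a where
  strip_0: "strip a 0 I I"
| strip_Suc: "strip a r I J \<Longrightarrow> i \<notin> I \<Longrightarrow> j \<notin> I \<Longrightarrow> a i \<noteq> a j \<Longrightarrow> strip a (Suc r) (insert i (insert j I)) J"

lemma strip_card:
  assumes "strip a r I J" "finite I"
  shows "finite J \<and> card I = card J + 2 * r"
  using assms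
proof induction
  case (strip_Suc r I J i j)
  then have "i \<noteq> j" by auto
  then show ?case using strip_Suc by simp
qed simp

text \<open>Every pair doubles the number of terms and lowers the level by 0 or 2, which leaves
  \<open>2 ^ r\<close> excesses on \<open>J\<close> at levels between \<open>k - 2 * r\<close> and
  \<open>k\<close>. The bound \<open>X\<close> has to be uniform in the constant because pairs shift
  it.\<close>

lemma excess_strip_le:
  assumes "strip a r I J" "finite I"
    and "\<And>c k'. k - 2 * int r \<le> k' \<Longrightarrow> k' \<le> k \<Longrightarrow> excess a c J k' \<le> X"
  shows "excess a c I k \<le> 2 ^ r * X"
  using assms
proof (induction arbitrary: c k)
  case (strip_Suc r I J i j)
  have "excess a c (insert i (insert j I)) k \<le> excess a c I k + excess a (c + a i + a j) I (k - 2)"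
    using strip_Suc by (intro excess_pair_le) auto
  also have "\<dots> \<le> 2 ^ r * X + 2 ^ r * X"
    using strip_Suc.prems by (intro add_mono strip_Suc.IH) auto
  finally show ?case by (simp add: mult_ac)
qed simp

text \<open>Pairing an element of a largest coefficient class with one outside it keeps the hypothesis
  true for the remaining set.\<close>

lemma strip_dichotomy:
  assumes "finite I" "2 * R \<le> card I" "\<And>g. R \<le> card {i \<in> I. a i \<noteq> g}"
  shows "\<exists>J. strip a R I J"
  using assms
proof (induction R arbitrary: I)
  case 0 then show ?case using strip_0 by blast
next
  case (Suc R)
  define N where "N g = card {i \<in> I. a i \<noteq> g}" for g
  have "\<exists>h\<in>a ` I. \<forall>g\<in>a ` I. N h \<le> N g"
  proof -
    have "finite (a ` I)" "a ` I \<noteq> {}" using Suc.prems by auto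
    from ex_is_arg_min_if_finite[OF this, of N] obtain h where "is_arg_min N (\<lambda>g. g \<in> a ` I) h" ..
    then show ?thesis by (metis is_arg_min_linorder)
  qed
  then obtain i where i: "i \<in> I" "\<And>u. u \<in> I \<Longrightarrow> N (a i) \<le> N (a u)" by auto
  have "{u \<in> I. a u \<noteq> a i} \<noteq> {}" using Suc.prems(3)[of "a i"] by (intro notI) simp
  then obtain j where j: "j \<in> I" "a j \<noteq> a i" by auto
  let ?I = "I - {i, j}"
  have ij: "i \<noteq> j" using j by auto
  have cardI: "card ?I = card I - 2" using i j ij by (simp add: card_Diff_subset Suc.prems)
  have step: "R \<le> card {u \<in> ?I. a u \<noteq> g}" for g
  proof -
    let ?S = "{u \<in> I. a u \<noteq> g}"
    have fS: "finite ?S" using Suc.prems by auto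
    have big: "Suc R \<le> card ?S" using Suc.prems by auto
    show ?thesis
    proof (cases "a i = g \<or> a j = g")
      case True
      then have "?S - (if a i = g then {j} else {i}) \<subseteq> {u \<in> ?I. a u \<noteq> g}" by (auto split: if_splits)
      then have "card (?S - (if a i = g then {j} else {i})) \<le> card {u \<in> ?I. a u \<noteq> g}"
        using Suc.prems by (intro card_mono) auto
      moreover have "card ?S - 1 \<le> card (?S - (if a i = g then {j} else {i}))"
        by (cases "a i = g") (auto simp: card_Diff_singleton_if)
      ultimately show ?thesis using big by linarith
    next
      case False
      have eq: "{u \<in> ?I. a u \<noteq> g} = ?S - {i, j}" by auto
      have c2: "card (?S - {i, j}) = card ?S - 2" using False i j ij by (simp add: card_Diff_subset)
      \<comment> \<open>Both \<open>i\<close> and \<open>j\<close> count towards \<open>?S\<close>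
        here, so \<open>Suc R\<close> is one too few. If \<open>g\<close> occurs, \<open>j\<close>
        lies neither in its class nor in that of \<open>a i\<close>, so the class of
        \<open>g\<close> has fewer than \<open>N (a i) \<le> N g\<close> elements; hence
        \<open>N g\<close> exceeds half of \<open>card I\<close>, which is at least
        \<open>R + 1\<close>.\<close>
      have "R + 2 \<le> card ?S"
      proof (cases "g \<in> a ` I")
        case gI: True
        then have le: "N (a i) \<le> N g" using i by auto
        have "{u \<in> I. a u = g} \<subseteq> {u \<in> I. a u \<noteq> a i} - {j}" using False by auto
        then have "card {u \<in> I. a u = g} \<le> card ({u \<in> I. a u \<noteq> a i} - {j})"
          using Suc.prems by (intro card_mono) auto
        also have "\<dots> < N (a i)"
          unfolding N_def using j Suc.prems by (intro card_Diff1_less) auto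
        finally have 1: "card {u \<in> I. a u = g} < N (a i)" .
        have "card I = card ({u \<in> I. a u = g} \<union> ?S)" by (rule arg_cong[where f=card]) blast
        also have "\<dots> = card {u \<in> I. a u = g} + card ?S"
          using Suc.prems(1) by (intro card_Un_disjoint) auto
        finally have "card I = card {u \<in> I. a u = g} + card ?S" .
        then show ?thesis using 1 le Suc.prems(2) unfolding N_def by presburger
      next
        case False
        then have "?S = I" by auto
        then have "card ?S = card I" by simp
        then show ?thesis using Suc.prems(2) by presburger
      qed
      then show ?thesis using eq c2 by simp
    qed
  qed
  have "\<exists>J. strip a R ?I J" using Suc.prems cardI step by (intro Suc.IH) auto
  then obtain J where "strip a R ?I J" ..
  then have "strip a (Suc R) (insert i (insert j ?I)) J" using j by (intro strip_Suc) auto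
  moreover have I: "insert i (insert j ?I) = I" using i j by auto
  ultimately show ?case unfolding I by blast
qed

text \<open>Each exceptional element but the last is paired with an element of the class of
  \<open>g\<close>. With one exception left, the excess can be computed explicitly.\<close>

lemma strip_to_single:
  assumes "finite I" "card {i \<in> I. a i \<noteq> g} = Suc r" "r \<le> card {i \<in> I. a i = g}"
  shows "\<exists>J. strip a r I J \<and> card {i \<in> J. a i \<noteq> g} = 1"
  using assms
proof (induction r arbitrary: I)
  case 0 then show ?case by (intro exI[of _ I] conjI strip_0) simp
next
  case (Suc r)
  from Suc.prems(2) have "{i \<in> I. a i \<noteq> g} \<noteq> {}" by (intro notI) simp
  then obtain i where i: "i \<in> I" "a i \<noteq> g" by blast
  from Suc.prems(3) have "{i \<in> I. a i = g} \<noteq> {}" by (intro notI) simp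
  then obtain j where j: "j \<in> I" "a j = g" by blast
  let ?I = "I - {i, j}"
  have "{u \<in> ?I. a u \<noteq> g} = {u \<in> I. a u \<noteq> g} - {i}" using j by auto
  then have 1: "card {u \<in> ?I. a u \<noteq> g} = Suc r" using Suc.prems i by simp
  have "{u \<in> ?I. a u = g} = {u \<in> I. a u = g} - {j}" using i by auto
  then have 2: "r \<le> card {u \<in> ?I. a u = g}" using Suc.prems j by simp
  obtain J where J: "strip a r ?I J" "card {i \<in> J. a i \<noteq> g} = 1"
    using Suc.IH[OF _ 1 2] Suc.prems by auto
  then have "strip a (Suc r) (insert i (insert j ?I)) J" using i j by (intro strip_Suc) auto
  moreover have I: "insert i (insert j ?I) = I" using i j by auto
  ultimately show ?case unfolding I using J(2) by blast
qed

section \<open>Growth of central binomial coefficients\<close>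

definition central :: "nat \<Rightarrow> real" where
  "central m = real (2 * m choose m)"

lemma central_nonneg: "0 \<le> central m"
  unfolding central_def by simp

lemma central_Suc: "central (Suc m) = central m * (4 * real m + 2) / (real m + 1)"
proof -
  have "Suc m * (Suc (Suc (2 * m)) choose Suc m) = Suc (Suc (2 * m)) * (Suc (2 * m) choose m)"
    by (rule Suc_times_binomial)
  moreover have "Suc (2 * m) choose m = Suc (2 * m) choose Suc m"
    using binomial_symmetric[of m "Suc (2 * m)"] by (simp add: Suc_diff_le)
  moreover have "Suc m * (Suc (2 * m) choose Suc m) = Suc (2 * m) * (2 * m choose m)"
    by (rule Suc_times_binomial)
  ultimately have "Suc m * (Suc m * (2 * Suc m choose Suc m)) = Suc (Suc (2 * m)) * (Suc (2 * m) * (2 * m choose m))"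
    by (metis mult.left_commute mult_Suc_right add_2_eq_Suc)
  also have "\<dots> = Suc m * ((4 * m + 2) * (2 * m choose m))"
    by (simp add: algebra_simps)
  finally have "Suc m * (2 * Suc m choose Suc m) = (4 * m + 2) * (2 * m choose m)"
    by (metis mult_left_cancel nat.distinct(1))
  then have "real (Suc m * (2 * Suc m choose Suc m)) = real ((4 * m + 2) * (2 * m choose m))"
    by (rule arg_cong)
  then have "(real m + 1) * central (Suc m) = central m * (4 * real m + 2)"
    unfolding central_def of_nat_mult by (simp add: mult.commute add.commute)
  then show ?thesis by (simp add: eq_divide_eq mult.commute)
qed

lemma central_small:
  "central 1 = 2" "central 2 = 6" "central 4 = 70" "central 5 = 252"
  by (simp_all add: central_def eval_nat_numeral)

text \<open>One more pair multiplies the left-hand side by at most \<open>(4q+2)/(q+1)\<close>, \<open>q = m + r\<close>,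
  which is the growth factor of the right-hand side.\<close>

lemma central_growth_single:
  assumes "1 \<le> r" "r + 2 \<le> m"
  shows "real (m + r) * real r * 2 ^ r * central m \<le> real m * central (m + r)"
proof (cases "r = 1")
  case True
  have "real m \<ge> 3" using assms by simp
  then have "3 * real m \<le> real m * real m" by (intro mult_right_mono) auto
  then have "2 * (real m + 1) * (real m + 1) \<le> real m * (4 * real m + 2)"
    using \<open>real m \<ge> 3\<close> by (simp only: ring_distribs)
  then have "2 * (real m + 1) * (real m + 1) * central m \<le> real m * (4 * real m + 2) * central m"
    by (rule mult_right_mono) (rule central_nonneg)
  then show ?thesis using True by (simp add: central_Suc field_simps)
next
  case False
  then have r: "2 \<le> r" and m: "4 \<le> m" using assms by auto
  \<comment> \<open>The induction starts at 2: the factor \<open>(r + 1) / r\<close> is too large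
    for the step at \<open>r = 1\<close>, but at most 3/2 from there on, which suffices since
    \<open>m + r\<close> is at least 6.\<close>
  from r show ?thesis
  proof (induction r rule: dec_induct)
    case base
    have m4: "real m \<ge> 4" using m by simp
    \<comment> \<open>In terms of \<open>x\<close> the difference of the two sides below has only
      non-negative coefficients.\<close>
    define x where "x = real m - 4"
    have x: "0 \<le> x" "real m = x + 4" using m4 unfolding x_def by auto
    have "8 * (real m + 2)^2 * (real m + 1) \<le> real m * (4 * real m + 2) * (4 * real m + 6)"
      unfolding x(2) using x(1) by (simp add: power2_eq_square algebra_simps)
    then have "8 * (real m + 2)^2 * (real m + 1) * central m \<le> real m * (4 * real m + 2) * (4 * real m + 6) * central m"
      by (rule mult_right_mono) (rule central_nonneg)
    moreover have "central (m + 2) = central m * (4 * real m + 2) * (4 * real m + 6) / ((real m + 1) * (real m + 2))"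
      using central_Suc[of m] central_Suc[of "Suc m"] by (simp add: numeral_2_eq_2 algebra_simps)
    moreover define D N where "D = (real m + 1) * (real m + 2)"
      and "N = central m * (4 * real m + 2) * (4 * real m + 6)"
    ultimately have "(real m + 2) * 8 * central m * D \<le> real m * N" and "central (m + 2) = N / D"
      by (simp_all only: power2_eq_square mult_ac)
    moreover have "0 < D" unfolding D_def by simp
    ultimately show ?case by (simp add: pos_le_divide_eq mult_ac add.commute)
  next
    case (step r)
    define q where "q = real (m + r)"
    define X where "X = 2 ^ r * central m"
    have X: "0 \<le> X" unfolding X_def by (simp add: central_nonneg)
    have q: "6 \<le> q" and r: "2 \<le> real r" using m step by (auto simp: q_def)
    have "(q + 1) * (q + 1) * (real r + 1) \<le> (q + 1) * (q + 1) * (3 / 2 * real r)"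
      using r q by (intro mult_left_mono) auto
    also have "\<dots> = (3 / 2 * ((q + 1) * (q + 1))) * real r" by simp
    also have "\<dots> \<le> ((2 * q + 1) * q) * real r"
    proof (rule mult_right_mono)
      have "6 * q \<le> q * q" using q by (intro mult_right_mono) auto
      then show "3 / 2 * ((q + 1) * (q + 1)) \<le> (2 * q + 1) * q" using q by (simp only: ring_distribs)
    qed simp
    finally have "2 * ((q + 1) * (q + 1) * (real r + 1)) * X \<le> 2 * ((2 * q + 1) * q * real r) * X"
      using X by (intro mult_right_mono) auto
    also have "\<dots> = (4 * q + 2) * (q * real r * X)" by (simp add: algebra_simps)
    also have "\<dots> \<le> (4 * q + 2) * (real m * central (m + r))"
      using step.IH q unfolding q_def X_def by (intro mult_left_mono) (auto simp: mult_ac)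
    finally have "(q + 1) * ((q + 1) * (real r + 1) * 2 * X) \<le> (4 * q + 2) * (real m * central (m + r))"
      by (simp add: mult_ac)
    then have "(q + 1) * (real r + 1) * 2 * X \<le> (4 * q + 2) * (real m * central (m + r)) / (q + 1)"
      using q by (simp add: field_simps)
    then show ?case unfolding X_def q_def by (simp add: central_Suc algebra_simps)
  qed
qed

text \<open>With \<open>q = m + r\<close>, one more pair multiplies the left-hand side by
  \<open>2 * (q + 1) / q\<close> and the right-hand side by \<open>(4 * q + 2) / (q + 1)\<close>,
  which is no smaller once \<open>q \<ge> 2\<close>.\<close>

lemma central_growth_step:
  assumes "real (m + r) * 2 ^ r * central m \<le> central (m + r)" "2 \<le> m + r"
  shows "real (m + Suc r) * 2 ^ Suc r * central m \<le> central (m + Suc r)"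
proof -
  define q where "q = real (m + r)"
  define X where "X = 2 ^ r * central m"
  have X: "0 \<le> X" unfolding X_def by (simp add: central_nonneg)
  have q: "2 \<le> q" using assms(2) by (auto simp: q_def)
  have "2 * q \<le> q * q" using q by (intro mult_right_mono) auto
  then have "2 * ((q + 1) * (q + 1)) \<le> (4 * q + 2) * q" using q by (simp only: ring_distribs)
  then have "2 * ((q + 1) * (q + 1)) * X \<le> (4 * q + 2) * q * X"
    using X by (intro mult_right_mono) auto
  also have "\<dots> \<le> (4 * q + 2) * central (m + r)"
    using assms(1) q unfolding q_def X_def mult.assoc by (intro mult_left_mono) (auto simp: mult_ac)
  finally have "(q + 1) * ((q + 1) * 2 * X) \<le> (4 * q + 2) * central (m + r)"
    by (simp add: mult_ac)
  then have "(q + 1) * 2 * X \<le> (4 * q + 2) * central (m + r) / (q + 1)"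
    using q by (simp add: field_simps)
  then show ?thesis unfolding X_def q_def by (simp add: central_Suc algebra_simps)
qed

text \<open>Induction along the diagonal \<open>r = m + 1\<close>, where raising \<open>m\<close> by
  one raises \<open>m + r\<close> by two. The base case \<open>m = 2\<close> reads 240 \<le> 252; at
  \<open>m = 1\<close> the inequality would be 24 \<le> 20, which is false.\<close>

lemma central_growth_double:
  assumes "2 \<le> m"
  shows "real (m + Suc m) * 2 ^ Suc m * central m \<le> central (m + Suc m)"
  using assms
proof (induction m rule: dec_induct)
  case base
  then show ?case using central_small by (simp add: eval_nat_numeral)
next
  case (step m)
  define x where "x = real m"
  have x: "2 \<le> x" using step by (simp add: x_def)
  define L where "L = 2 ^ Suc m * central m"
  have L: "0 \<le> L" unfolding L_def by (simp add: central_nonneg)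
  have IH: "(2 * x + 1) * L \<le> central (m + Suc m)"
    using step.IH unfolding L_def x_def by (simp add: algebra_simps)
  have c: "central (Suc m + Suc (Suc m)) =
      central (m + Suc m) * (8 * x + 6) / (2 * x + 2) * (8 * x + 10) / (2 * x + 3)"
    using central_Suc[of "m + Suc m"] central_Suc[of "Suc (m + Suc m)"]
    unfolding x_def by (simp add: algebra_simps)
  have l: "real (Suc m + Suc (Suc m)) * 2 ^ Suc (Suc m) * central (Suc m)
      = (2 * x + 3) * 2 * L * (4 * x + 2) / (x + 1)"
  proof -
    have 3: "real (Suc m + Suc (Suc m)) = 2 * x + 3" unfolding x_def by simp
    show ?thesis unfolding 3 central_Suc L_def x_def[symmetric] by simp (simp add: algebra_simps)
  qed
  have "(2 * x + 3) * (2 * x + 3) * 4 \<le> (8 * x + 6) * (8 * x + 10) / 2"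
    using x mult_mono[of 2 x 2 x] by (simp add: algebra_simps)
  then have "(2 * x + 3) * (2 * x + 3) * 4 * ((2 * x + 1) * L)
      \<le> (8 * x + 6) * (8 * x + 10) / 2 * central (m + Suc m)"
    using IH x L by (intro mult_mono) auto
  then have "(2 * x + 3) * 4 * ((2 * x + 1) * L)
      \<le> (8 * x + 6) * (8 * x + 10) / 2 * central (m + Suc m) / (2 * x + 3)"
    using x by (simp only: pos_le_divide_eq mult_ac)
  then have "(2 * x + 3) * 4 * ((2 * x + 1) * L) / (x + 1)
      \<le> (8 * x + 6) * (8 * x + 10) / 2 * central (m + Suc m) / (2 * x + 3) / (x + 1)"
    using x by (intro divide_right_mono) auto
  moreover have "(2 * x + 3) * 2 * L * (4 * x + 2) / (x + 1) = (2 * x + 3) * 4 * ((2 * x + 1) * L) / (x + 1)"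
    by (simp add: algebra_simps)
  moreover have "central (m + Suc m) * (8 * x + 6) / (2 * x + 2) * (8 * x + 10) / (2 * x + 3)
      = (8 * x + 6) * (8 * x + 10) / 2 * central (m + Suc m) / (2 * x + 3) / (x + 1)"
    using x by (simp add: divide_simps) (simp add: algebra_simps)
  ultimately show ?case unfolding c l by linarith
qed

text \<open>The diagonal case starts an induction on \<open>r\<close> with \<open>m\<close>
  fixed.\<close>

lemma central_growth:
  assumes "2 \<le> m" "Suc m \<le> r"
  shows "real (m + r) * 2 ^ r * central m \<le> central (m + r)"
  using assms(2)
proof (induction r rule: dec_induct)
  case base
  then show ?case using central_growth_double assms by simp
next
  case (step r)
  then show ?case using assms by (intro central_growth_step) auto
qed

section \<open>Excess on the middle layer\<close>

lemma card_layer_le_central: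
  assumes "finite J" "card J = 2 * m"
  shows "card (layer J k) \<le> central m"
proof (cases "0 \<le> k")
  case True
  then obtain p where "k = int p" using nonneg_int_cases by blast
  then show ?thesis using assms binomial_maximum[of "2 * m" p] unfolding central_def by (simp add: card_layer)
next
  case False
  then show ?thesis by (simp add: layer_neg central_nonneg)
qed

text \<open>The \<open>p\<close>-fold multiple of a group element \<open>g\<close> is expressed as
  the sum of \<open>p\<close> copies of \<open>g\<close>.\<close>

lemma sum_const_card:
  fixes g :: "'g::ab_group_add"
  shows "finite A \<Longrightarrow> (\<Sum>i\<in>A. g) = (\<Sum>i<card A. g)"
  by (induction rule: finite_induct) (simp_all add: add.commute)

lemma sum_eq_card:
  assumes "finite A" "\<And>i. i \<in> A \<Longrightarrow> a i = g"
  shows "sum a A = (\<Sum>i<card A. g::'g::ab_group_add)"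
  using sum_const_card[OF assms(1), of g] assms(2) by (simp cong: sum.cong)

lemma excess_const:
  assumes "finite Z" "\<And>i. i \<in> Z \<Longrightarrow> a i = g"
  shows "excess a c Z (int p) = real (card Z choose p) * (if (\<Sum>i<p. g) + c = 0 then 1 else - 1)"
proof -
  have "sum a A = (\<Sum>i<p. g)" if "A \<in> layer Z (int p)" for A
    using sum_eq_card[of A a g] in_layerD[OF that assms(1)] assms(2) by (simp add: subset_eq)
  then show ?thesis unfolding excess_def using assms(1) by (simp add: card_layer)
qed

text \<open>All sets avoiding the exceptional element have one value, all sets containing it
  another, and the two are not both zero. The excess is thus at most the difference of the binomial
  coefficients \<open>2 * m - 1\<close> over \<open>p\<close> and over \<open>p - 1\<close>, which
  in absolute value is the fraction \<open>\<bar>m - p\<bar> / m\<close> of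
  \<open>2 * m choose p\<close>.\<close>

lemma excess_single:
  assumes "finite J" "card {i \<in> J. a i \<noteq> g} = 1" "card J = 2 * m" "r + 2 \<le> m"
    and "int m - int r \<le> k" "k \<le> int m + int r"
  shows "excess a c J k \<le> real r / real m * central m"
proof -
  obtain i where i: "{u \<in> J. a u \<noteq> g} = {i}" using assms(2) by (rule card_1_singletonE)
  define Z where "Z = J - {i}"
  have J: "J = insert i Z" "i \<notin> Z" "finite Z" and ai: "a i \<noteq> g" and Zg: "\<And>u. u \<in> Z \<Longrightarrow> a u = g"
    using i assms(1) unfolding Z_def by auto
  have cZ: "card Z = 2 * m - 1" using J assms(3) by simp
  obtain p where k: "k = int p" using assms by (metis nonneg_int_cases of_nat_le_iff diff_ge_0_iff_ge order_trans le_add1 add_leD1)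
  have p: "0 < p" "m - r \<le> p" "p \<le> m + r" "p < 2 * m" using assms k by auto
  let ?C = "real (2 * m choose p)" and ?C1 = "real ((2 * m - 1) choose p)" and ?C2 = "real ((2 * m - 1) choose (p - 1))"
  define s where "s = (\<Sum>i<p - 1. g)"
  have sp: "(\<Sum>i<p. g) = s + g" unfolding s_def using p(1) by (cases p) auto
  have p1: "k - 1 = int (p - 1)" using k p(1) by simp
  have e: "excess a c J k = ?C1 * (if s + g + c = 0 then 1 else - 1) + ?C2 * (if s + (c + a i) = 0 then 1 else - 1)"
    using excess_const[of Z a g c p] excess_const[of Z a g "c + a i" "p - 1"] J(3) Zg
    unfolding J(1) excess_insert[OF J(3,2)] p1 cZ sp s_def[symmetric] unfolding k by simp
  have "\<not> (s + g + c = 0 \<and> s + (c + a i) = 0)"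
  proof
    assume "s + g + c = 0 \<and> s + (c + a i) = 0"
    then have "(s + c) + g = (s + c) + a i" by (simp add: algebra_simps)
    then show False using ai by simp
  qed
  then have "excess a c J k \<le> \<bar>?C1 - ?C2\<bar>" unfolding e by auto
  also have "\<dots> \<le> real r / real m * ?C"
  proof -
    have "p * (2 * m choose p) = 2 * m * ((2 * m - 1) choose (p - 1))"
      using p by (intro times_binomial_minus1_eq) auto
    then have 2: "real p * ?C = 2 * real m * ?C2" by (metis of_nat_mult of_nat_numeral)
    have "(2 * m - p) * (2 * m choose p) = 2 * m * ((2 * m - 1) choose p)"
      by (rule binomial_absorb_comp)
    then have "real (2 * m - p) * ?C = 2 * real m * ?C1" by (metis of_nat_mult of_nat_numeral)
    then have 1: "(2 * real m - real p) * ?C = 2 * real m * ?C1" using p by (simp add: of_nat_diff)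
    have m: "0 < real m" using assms(4) by simp
    have "real m * (?C1 - ?C2) = (real m - real p) * ?C" using 1 2 by (simp add: algebra_simps)
    then have "real m * \<bar>?C1 - ?C2\<bar> = \<bar>real m - real p\<bar> * ?C" using m by (metis abs_mult abs_of_nat)
    also have "\<dots> \<le> real r * ?C" using p assms(4) by (intro mult_right_mono) auto
    finally show ?thesis using m by (simp add: field_simps)
  qed
  also have "\<dots> \<le> real r / real m * central m"
    using binomial_maximum[of "2 * m" p] unfolding central_def by (intro mult_left_mono) auto
  finally show ?thesis .
qed

lemma excess_middle:
  assumes "finite I" "card I = 2 * k" "4 \<le> k" "\<And>g. \<exists>i\<in>I. a i \<noteq> g"
  shows "real k * excess a c I (int k) \<le> central k"
proof -
  \<comment> \<open>The split is as even as possible subject to \<open>R \<ge> m + 1\<close>, as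
    \<open>central_growth\<close> requires. In the other case fewer than \<open>R\<close>
    coefficients are exceptional, and \<open>R \<le> m + 2\<close> then yields
    \<open>r + 2 \<le> M\<close>.\<close>
  define m where "m = (k - 1) div 2"
  define R where "R = k - m"
  have mR: "m + R = k" "Suc m \<le> R" "R \<le> m + 2" "1 \<le> m" using assms(3) unfolding m_def R_def by auto
  show ?thesis
  proof (cases "\<exists>J. strip a R I J")
    case True
    then obtain J where J: "strip a R I J" ..
    then have "finite J" "card J = 2 * m" using strip_card[OF J assms(1)] assms(2) mR by auto
    then have "excess a c' J k' \<le> central m" for c' k'
      using excess_le_card[of J a c' k'] card_layer_le_central[of J m k'] by simp
    then have "excess a c I (int k) \<le> 2 ^ R * central m"
      by (intro excess_strip_le[OF J assms(1)])
    then have "real k * excess a c I (int k) \<le> real k * (2 ^ R * central m)"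
      by (rule mult_left_mono) simp
    also have "\<dots> \<le> central k"
    \<comment> \<open>\<open>central_growth\<close> starts at \<open>m = 2\<close>. The remaining
      case is \<open>k = 4\<close>, \<open>R = 3\<close>, where the claim is 64 \<le> 70.\<close>
    proof (cases "m = 1")
      case True
      then have "R = 3" "k = 4" using mR assms(3) by auto
      then show ?thesis using True central_small by simp
    next
      case False
      then show ?thesis using central_growth[of m R] mR by (simp add: mult.assoc)
    qed
    finally show ?thesis .
  next
    case False
    moreover have "2 * R \<le> card I" using assms(2) mR by linarith
    ultimately obtain g where g: "card {i \<in> I. a i \<noteq> g} < R"
      using strip_dichotomy[OF assms(1), of R a] not_le by blast
    have "card {i \<in> I. a i \<noteq> g} \<noteq> 0" using assms(1,4) by auto
    then obtain r where r: "card {i \<in> I. a i \<noteq> g} = Suc r" using not0_implies_Suc by blast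
    \<comment> \<open>After \<open>r\<close> pairs \<open>2 * M\<close> elements remain, and the
      levels reached from \<open>k\<close> run from \<open>M - r\<close> to \<open>M + r\<close>,
      the window of \<open>excess_single\<close>.\<close>
    define M where "M = k - r"
    have M: "M + r = k" "r + 2 \<le> M" using g r mR unfolding M_def by auto
    have "card I = card ({i \<in> I. a i = g} \<union> {i \<in> I. a i \<noteq> g})" by (rule arg_cong[where f=card]) blast
    also have "\<dots> = card {i \<in> I. a i = g} + card {i \<in> I. a i \<noteq> g}"
      using assms(1) by (intro card_Un_disjoint) auto
    finally have "r \<le> card {i \<in> I. a i = g}" using assms(2) M r by linarith
    from strip_to_single[OF assms(1) r this] obtain J
      where J: "strip a r I J" "card {i \<in> J. a i \<noteq> g} = 1" by blast
    then have fJ: "finite J" "card J = 2 * M" using strip_card[OF J(1) assms(1)] assms(2) M by auto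
    have "excess a c I (int k) \<le> 2 ^ r * (real r / real M * central M)"
      using M by (intro excess_strip_le[OF J(1) assms(1)] excess_single[OF fJ(1) J(2) fJ(2)]) auto
    then have "real k * excess a c I (int k) \<le> real k * (2 ^ r * (real r / real M * central M))"
      by (rule mult_left_mono) simp
    also have "\<dots> = real (M + r) * real r * 2 ^ r * central M / real M" using M by simp
    also have "\<dots> \<le> central k"
    proof (cases "r = 0")
      case False
      then show ?thesis using central_growth_single[of r M] M by (simp add: field_simps)
    qed (simp add: central_nonneg)
    finally show ?thesis .
  qed
qed

section \<open>Counting non-zeros on the middle layer\<close>

lemma layer_eq_const_sum:
  assumes "finite I" "\<And>i. i \<in> I \<Longrightarrow> a i = (g::'g::ab_group_add)" "A \<in> layer I k" "B \<in> layer I k"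
  shows "sum a A = sum a B"
proof -
  note A = in_layerD[OF assms(3,1)] and B = in_layerD[OF assms(4,1)]
  have "card A = card B" using A(3) B(3) by simp
  moreover have "sum a A = (\<Sum>i<card A. g)" using A assms(2) by (intro sum_eq_card) auto
  moreover have "sum a B = (\<Sum>i<card B. g)" using B assms(2) by (intro sum_eq_card) auto
  ultimately show ?thesis by simp
qed

lemma nonzeros_const:
  assumes "finite I" "\<And>i. i \<in> I \<Longrightarrow> a i = (g::'g::ab_group_add)" "nonzeros a c I k \<noteq> {}"
  shows "nonzeros a c I k = layer I k"
proof -
  obtain B where B: "B \<in> layer I k" "sum a B + c \<noteq> 0" using assms(3) unfolding nonzeros_def by blast
  then have "sum a A + c \<noteq> 0" if "A \<in> layer I k" for A
    using layer_eq_const_sum[OF assms(1,2) that B(1)] by simp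
  then show ?thesis unfolding nonzeros_def by blast
qed

lemma card_nonzeros_excess:
  assumes "finite I"
  shows "2 * real (card (nonzeros a c I k)) = card (layer I k) - excess a c I k"
proof -
  have "excess a c I k = (\<Sum>A\<in>layer I k. 1 - 2 * (if sum a A + c \<noteq> 0 then 1 else 0 :: real))"
    unfolding excess_def by (intro sum.cong) auto
  also have "\<dots> = real (card (layer I k)) - 2 * (\<Sum>A\<in>layer I k. if sum a A + c \<noteq> 0 then 1 else 0)"
    by (simp add: sum_subtractf sum_distrib_left)
  also have "(\<Sum>A\<in>layer I k. if sum a A + c \<noteq> 0 then 1 else 0) = real (card (nonzeros a c I k))"
    using sum.inter_filter[OF finite_layer[OF assms, of k], of "\<lambda>_. 1::real" "\<lambda>A. sum a A + c \<noteq> 0"]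
    unfolding nonzeros_def by simp
  finally show ?thesis by simp
qed

text \<open>An excess of at most a \<open>1 / k\<close> fraction of the layer leaves at least a
  fraction \<open>(1 - 1 / k) / 2\<close> of non-zeros, which is \<open>(k - 1) / n\<close> for
  \<open>n = 2 * k\<close>.\<close>

lemma nonzeros_middle:
  assumes "finite I" "card I = 2 * k" "4 \<le> k" "nonzeros a c I (int k) \<noteq> {}"
  shows "(real k - 1) * (card I choose k) \<le> card I * card (nonzeros a c I (int k))"
proof (cases "\<exists>g. \<forall>i\<in>I. a i = g")
  case True
  then obtain g where "\<And>i. i \<in> I \<Longrightarrow> a i = g" by blast
  from nonzeros_const[OF assms(1) this assms(4)]
  have "card (nonzeros a c I (int k)) = card I choose k" using assms(1) by (simp add: card_layer)
  then show ?thesis using assms(2) by (simp add: mult_right_mono)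
next
  case False
  then have "real k * excess a c I (int k) \<le> central k"
    using assms by (intro excess_middle) auto
  moreover have "2 * real (card (nonzeros a c I (int k))) = central k - excess a c I (int k)"
    using card_nonzeros_excess[OF assms(1), of a c "int k"] assms(1,2) by (simp add: card_layer central_def)
  then have "real k * (2 * real (card (nonzeros a c I (int k)))) = real k * (central k - excess a c I (int k))"
    by simp
  ultimately show ?thesis using assms(2) by (simp add: algebra_simps central_def)
qed

section \<open>Averaging over restrictions for levels below the middle\<close>

text \<open>Double counting of the pairs of a non-zero and an index outside it; deleting
  \<open>i\<close> from the index set is the restriction that sets the variable \<open>i\<close> to
  0.\<close>

lemma sum_card_nonzeros_delete:
  assumes "finite I"
  shows "(\<Sum>i\<in>I. card (nonzeros a c (I - {i}) (int k))) = (card I - k) * card (nonzeros a c I (int k))"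
proof -
  have "nonzeros a c (I - {i}) (int k) = {A \<in> nonzeros a c I (int k). i \<notin> A}" for i
    unfolding nonzeros_def layer_def by auto
  then have "(\<Sum>i\<in>I. card (nonzeros a c (I - {i}) (int k))) = (\<Sum>i\<in>I. card {A \<in> nonzeros a c I (int k). i \<notin> A})"
    by simp
  also have "\<dots> = (\<Sum>A\<in>nonzeros a c I (int k). card I - k)"
  proof (rule sum_multicount_gen)
    show "\<forall>A\<in>nonzeros a c I (int k). card {i \<in> I. i \<notin> A} = card I - k"
    proof
      fix A assume "A \<in> nonzeros a c I (int k)"
      then have "A \<in> layer I (int k)" unfolding nonzeros_def by simp
      from in_layerD[OF this assms] have "A \<subseteq> I" "finite A" "card A = k" by auto
      moreover have "{i \<in> I. i \<notin> A} = I - A" by auto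
      ultimately show "card {i \<in> I. i \<notin> A} = card I - k" by (simp add: card_Diff_subset)
    qed
  qed (use assms in auto)
  finally show ?thesis by (simp add: mult.commute)
qed

lemma insert_in_layer:
  assumes "T \<in> layer J (int k)" "finite J" "i \<notin> J" "J \<subseteq> I" "i \<in> I"
  shows "insert i T \<in> layer I (int (Suc k))"
proof -
  note T = in_layerD[OF assms(1,2)]
  have "i \<notin> T" using T(1) assms(3) by blast
  then show ?thesis using T assms(4,5) unfolding layer_def by auto
qed

text \<open>There is room for a \<open>k\<close>-set \<open>T\<close> avoiding \<open>u\<close> and
  \<open>v\<close>; adding \<open>u\<close> or \<open>v\<close> to it gives two zeros that differ
  only in \<open>a u\<close> and \<open>a v\<close>.\<close>

lemma const_if_nonzeros_empty:
  fixes a :: "'i \<Rightarrow> 'g::ab_group_add"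
  assumes "finite J" "nonzeros a c J (int (Suc k)) = {}" "k + 2 \<le> card J" "u \<in> J" "v \<in> J"
  shows "a u = a v"
proof (cases "u = v")
  case False
  then have "k \<le> card (J - {u, v})" using assms by (simp add: card_Diff_subset)
  then obtain T where T: "T \<subseteq> J - {u, v}" "card T = k" by (rule obtain_subset_with_card_n)
  have fT: "finite T" using T(1) assms(1) by (meson finite_Diff finite_subset)
  have "T \<in> layer (J - {w}) (int k)" if "w \<in> {u, v}" for w using T that unfolding layer_def by auto
  then have "insert w T \<in> layer J (int (Suc k))" if "w \<in> {u, v}" for w
    using that assms by (intro insert_in_layer[of T "J - {w}"]) auto
  then have "sum a (insert w T) + c = 0" if "w \<in> {u, v}" for w
    using assms(2) that unfolding nonzeros_def by blast
  then have "a w + sum a T + c = 0" if "w \<in> {u, v}" for w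
    using that T(1) fT by (metis (no_types, lifting) Diff_iff subsetD sum.insert)
  from this[of u] this[of v] have "a u + sum a T + c = 0" "a v + sum a T + c = 0" by blast+
  then show ?thesis by (metis add_right_cancel)
qed simp

text \<open>Induction on \<open>n\<close> from the middle layer. If no restriction vanishes,
  averaging preserves the fraction \<open>(k - 1) / n\<close>, which is at least the required
  \<open>(k - 1) / (n + 1)\<close>.\<close>

lemma nonzeros_half_large:
  fixes a :: "'i \<Rightarrow> 'g::ab_group_add"
  assumes "4 \<le> k" "finite I" "card I = n" "2 * k \<le> n" "nonzeros a c I (int k) \<noteq> {}"
  shows "(real k - 1) * (n choose k) \<le> n * card (nonzeros a c I (int k))"
  using assms(4,2,3,5)
proof (induction n arbitrary: I rule: dec_induct)
  case base
  then show ?case using nonzeros_middle[of I k a c] assms(1) by simp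
next
  case (step n)
  let ?N = "card (nonzeros a c I (int k))"
  show ?case
  proof (cases "\<exists>i\<in>I. nonzeros a c (I - {i}) (int k) = {}")
    case True
    then obtain i where i: "i \<in> I" "nonzeros a c (I - {i}) (int k) = {}" by blast
    define J where "J = I - {i}"
    have J: "finite J" "card J = n" "i \<notin> J" "J \<subseteq> I" using step.prems i unfolding J_def by auto
    obtain l where l: "k = Suc l" using assms(1) by (cases k) auto
    have empty: "nonzeros a c J (int (Suc l)) = {}" using i(2) unfolding J_def l .
    have l2: "l + 2 \<le> card J" using J l step.hyps assms(1) by auto
    have "J \<noteq> {}" using l2 by auto
    then obtain v where v: "v \<in> J" by blast
    have const: "a u = a v" if "u \<in> J" for u
      using const_if_nonzeros_empty[OF J(1) empty l2 that v] .
    obtain B where B: "B \<in> nonzeros a c I (int k)" using step.prems by blast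
    then have BI: "B \<in> layer I (int k)" and Bn: "sum a B + c \<noteq> 0" unfolding nonzeros_def by auto
    note BD = in_layerD[OF BI step.prems(1)]
    have iB: "i \<in> B"
    proof (rule ccontr)
      assume "i \<notin> B"
      then have "B \<in> nonzeros a c J (int (Suc l))"
        using BD Bn unfolding nonzeros_def layer_def J_def l by auto
      then show False using empty by blast
    qed
    \<comment> \<open>The coefficients on \<open>J\<close> agree, so every set of the layer that
      contains \<open>i\<close> has the same value as \<open>B\<close> and is a non-zero
      too.\<close>
    have Bl: "B - {i} \<in> layer J (int l)"
      using BD iB l unfolding layer_def J_def by auto
    have "insert i T \<in> nonzeros a c I (int k)" if T: "T \<in> layer J (int l)" for T
    proof -
      have "i \<notin> T" "finite T" using in_layerD[OF T J(1)] J(3) by auto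
      then have "sum a (insert i T) = a i + sum a T" by simp
      also have "sum a T = sum a (B - {i})"
        using layer_eq_const_sum[OF J(1) const T Bl] .
      also have "a i + sum a (B - {i}) = sum a B" using sum.remove[OF BD(2) iB, of a] by simp
      finally have "sum a (insert i T) + c \<noteq> 0" using Bn by simp
      moreover have "insert i T \<in> layer I (int k)"
        unfolding l using insert_in_layer[OF T J(1) J(3) J(4) i(1)] .
      ultimately show ?thesis unfolding nonzeros_def by simp
    qed
    moreover have "inj_on (insert i) (layer J (int l))"
    proof (rule inj_onI)
      fix S T assume "S \<in> layer J (int l)" "T \<in> layer J (int l)" "insert i S = insert i T"
      moreover from this have "i \<notin> S" "i \<notin> T" using in_layerD(1) J(1,3) by blast+
      ultimately show "S = T" by (metis insert_ident)
    qed
    ultimately have "card (layer J (int l)) \<le> ?N"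
      using step.prems(1) by (intro card_inj_on_le[where f="insert i"]) auto
    then have le: "n choose l \<le> ?N" using J by (simp add: card_layer)
    \<comment> \<open>The sets containing \<open>i\<close> form a fraction
      \<open>k / (n + 1)\<close> of the layer, more than required.\<close>
    have "k * (Suc n choose k) = Suc n * (n choose l)" unfolding l by (rule Suc_times_binomial)
    also have "\<dots> \<le> Suc n * ?N" using le by (rule mult_le_mono2)
    finally have "real k * (Suc n choose k) \<le> Suc n * ?N" by (metis of_nat_le_iff of_nat_mult)
    moreover have "(real k - 1) * (Suc n choose k) \<le> real k * (Suc n choose k)"
      by (intro mult_right_mono) auto
    ultimately show ?thesis by linarith
  next
    case False
    have le: "(real k - 1) * (n choose k) \<le> n * card (nonzeros a c (I - {i}) (int k))" if "i \<in> I" for i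
      using step.IH[of "I - {i}"] step.prems that False by auto
    have "real (Suc n) * ((real k - 1) * (n choose k)) = (\<Sum>i\<in>I. (real k - 1) * (n choose k))"
      using step.prems(2) by simp
    also have "\<dots> \<le> (\<Sum>i\<in>I. real (n * card (nonzeros a c (I - {i}) (int k))))"
      by (rule sum_mono) (rule le)
    also have "\<dots> = real (n * ((Suc n - k) * ?N))"
      using sum_card_nonzeros_delete[OF step.prems(1), of a c k] step.prems(2)
      by (simp flip: sum_distrib_left of_nat_sum)
    also have "\<dots> = real (Suc n - k) * (n * ?N)" by (simp only: of_nat_mult mult_ac)
    finally have "(real k - 1) * (real (Suc n) * (n choose k)) \<le> real (Suc n - k) * (n * ?N)"
      by (simp only: mult_ac)
    moreover have "(Suc n - k) * (Suc n choose k) = Suc n * (n choose k)"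
      using binomial_absorb_comp[of "Suc n" k] by simp
    then have "real (Suc n) * (n choose k) = real (Suc n - k) * (Suc n choose k)"
      by (metis of_nat_mult)
    ultimately have "real (Suc n - k) * ((real k - 1) * (Suc n choose k)) \<le> real (Suc n - k) * (n * ?N)"
      by (simp only: mult_ac)
    then have "(real k - 1) * (Suc n choose k) \<le> real (n * ?N)"
      using step.hyps assms(1) by (subst (asm) mult_le_cancel_left_pos) auto
    also have "\<dots> \<le> Suc n * ?N" by simp
    finally show ?thesis by simp
  qed
qed

section \<open>Small levels by a single pair\<close>

text \<open>For a \<open>k\<close>-set \<open>T\<close> avoiding both indices, adding
  \<open>i\<close> and adding \<open>j\<close> give different values, so one of them is a non-zero.
  Choosing it is injective, since removing \<open>i\<close> and \<open>j\<close> recovers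
  \<open>T\<close>.\<close>

lemma card_nonzeros_pair:
  fixes a :: "'i \<Rightarrow> 'g::ab_group_add"
  assumes "finite I" "i \<in> I" "j \<in> I" "a i \<noteq> a j"
  shows "(card I - 2) choose k \<le> card (nonzeros a c I (int (Suc k)))"
proof -
  define J where "J = I - {i, j}"
  have ij: "i \<noteq> j" using assms(4) by auto
  have J: "finite J" "card J = card I - 2" "i \<notin> J" "j \<notin> J" "J \<subseteq> I"
    using assms ij unfolding J_def by (auto simp: card_Diff_subset)
  define f where "f T = (if sum a (insert i T) + c \<noteq> 0 then insert i T else insert j T)" for T
  have "f T \<in> nonzeros a c I (int (Suc k))" if T: "T \<in> layer J (int k)" for T
  proof -
    have "i \<notin> T" "j \<notin> T" "finite T" using in_layerD[OF T J(1)] J by auto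
    then have "sum a (insert i T) \<noteq> sum a (insert j T)" using assms(4) by simp
    then have "sum a (f T) + c \<noteq> 0" unfolding f_def by (auto simp: add_eq_0_iff2)
    then show ?thesis
      using insert_in_layer[OF T J(1) J(3) J(5) assms(2)] insert_in_layer[OF T J(1) J(4) J(5) assms(3)]
      unfolding nonzeros_def f_def by auto
  qed
  moreover have "f T - {i, j} = T" if "T \<in> layer J (int k)" for T
    using in_layerD[OF that J(1)] J unfolding f_def by auto
  then have "inj_on f (layer J (int k))" by (intro inj_onI) metis
  ultimately have "card (layer J (int k)) \<le> card (nonzeros a c I (int (Suc k)))"
    using assms(1) by (intro card_inj_on_le[where f=f]) auto
  then show ?thesis using J by (simp add: card_layer)
qed

lemma nonzeros_half_small:
  fixes a :: "'i \<Rightarrow> 'g::ab_group_add"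
  assumes "finite I" "8 \<le> card I" "1 \<le> k" "k < 4" "nonzeros a c I (int k) \<noteq> {}"
  shows "(real k - 1) * (card I choose k) \<le> card I * card (nonzeros a c I (int k))"
proof (cases "\<exists>i\<in>I. \<exists>j\<in>I. a i \<noteq> a j")
  case True
  then obtain i j where ij: "i \<in> I" "j \<in> I" "a i \<noteq> a j" by blast
  obtain l where l: "k = Suc l" using assms(3) by (cases k) auto
  define n where "n = card I"
  let ?N = "card (nonzeros a c I (int k))"
  have le: "(n - 2) choose l \<le> ?N" unfolding l n_def by (rule card_nonzeros_pair[where a=a, OF assms(1) ij])
  have n8: "8 \<le> n" using assms(2) n_def by simp
  have 1: "k * (n choose k) = n * ((n - 1) choose l)"
    using times_binomial_minus1_eq[of k n] l by simp
  have 2: "(n - 1 - l) * ((n - 1) choose l) = (n - 1) * ((n - 2) choose l)"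
    using binomial_absorb_comp[of "n - 1" l] by (simp add: numeral_2_eq_2)
  \<comment> \<open>The pair yields the fraction \<open>k * (n - k) / (n * (n - 1))\<close> of
    non-zeros, so this is the comparison with \<open>(k - 1) / n\<close>. At \<open>k = 3\<close>
    and \<open>n = 8\<close> it reads 14 \<le> 15.\<close>
  have "(k - 1) * (n - 1) \<le> k * (n - 1 - l)"
    using assms(3,4) n8 l by (auto simp: less_Suc_eq numeral_eq_Suc)
  then have "(k - 1) * (n - 1) * (n choose k) \<le> k * (n - 1 - l) * (n choose k)"
    by (rule mult_le_mono1)
  also have "\<dots> = (n - 1 - l) * (k * (n choose k))" by (simp only: mult_ac)
  also have "\<dots> = n * ((n - 1 - l) * ((n - 1) choose l))" unfolding 1 by (simp only: mult_ac)
  also have "\<dots> \<le> n * ((n - 1) * ?N)" unfolding 2 using le by simp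
  finally have "(n - 1) * ((k - 1) * (n choose k)) \<le> (n - 1) * (n * ?N)" by (simp only: mult_ac)
  then have "(k - 1) * (n choose k) \<le> n * ?N" using n8 by (subst (asm) mult_le_cancel1) auto
  then have "real ((k - 1) * (n choose k)) \<le> real (n * ?N)" by (simp only: of_nat_le_iff)
  then show ?thesis unfolding n_def using assms(3) by (simp add: of_nat_diff)
next
  case False
  then obtain g where "\<And>i. i \<in> I \<Longrightarrow> a i = g" by (cases "I = {}") blast+
  from nonzeros_const[OF assms(1) this assms(5)]
  have "card (nonzeros a c I (int k)) = card I choose k" using assms(1) by (simp add: card_layer)
  then show ?thesis using assms(2,4) by (auto intro!: mult_right_mono)
qed

section \<open>All levels, with complements above the middle\<close>

lemma card_nonzeros_half:
  fixes a :: "'i \<Rightarrow> 'g::ab_group_add"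
  assumes "finite I" "8 \<le> card I" "1 \<le> k" "2 * k \<le> card I" "nonzeros a c I (int k) \<noteq> {}"
  shows "(real k - 1) * (card I choose k) \<le> card I * card (nonzeros a c I (int k))"
  using nonzeros_half_small[of I k a c] nonzeros_half_large[of k I "card I" a c] assms
  by (cases "k < 4") auto

text \<open>Substituting 1 minus each variable negates the coefficients and adds their total to the
  constant.\<close>

lemma nonzeros_complement:
  fixes a :: "'i \<Rightarrow> 'g::ab_group_add"
  assumes "finite I"
  shows "bij_betw (\<lambda>A. I - A) (nonzeros a c I k) (nonzeros (\<lambda>i. - a i) (c + sum a I) I (int (card I) - k))"
proof -
  have *: "I - A \<in> layer I (int (card I) - l)" if "A \<in> layer I l" for A l
    using in_layerD[OF that assms] assms unfolding layer_def
    by (auto simp: card_Diff_subset of_nat_diff card_mono)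
  have s: "sum (\<lambda>i. - a i) (I - A) + (c + sum a I) = sum a A + c" if "A \<subseteq> I" for A
    using that assms by (simp add: sum_diff finite_subset sum_negf)
  have t: "sum (\<lambda>i. - a i) A + (c + sum a I) = sum a (I - A) + c" if "A \<subseteq> I" for A
    using that assms by (simp add: sum_diff finite_subset sum_negf)
  show ?thesis
  proof (rule bij_betw_byWitness[where f'="\<lambda>A. I - A"])
    show "(\<lambda>A. I - A) ` nonzeros a c I k \<subseteq> nonzeros (\<lambda>i. - a i) (c + sum a I) I (int (card I) - k)"
    proof (rule image_subsetI)
      fix A assume "A \<in> nonzeros a c I k"
      then have A: "A \<in> layer I k" "sum a A + c \<noteq> 0" unfolding nonzeros_def by auto
      then show "I - A \<in> nonzeros (\<lambda>i. - a i) (c + sum a I) I (int (card I) - k)"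
        unfolding nonzeros_def mem_Collect_eq s[OF in_layerD(1)[OF A(1) assms]] using *[OF A(1)] by blast
    qed
    show "(\<lambda>A. I - A) ` nonzeros (\<lambda>i. - a i) (c + sum a I) I (int (card I) - k) \<subseteq> nonzeros a c I k"
    proof (rule image_subsetI)
      fix A assume "A \<in> nonzeros (\<lambda>i. - a i) (c + sum a I) I (int (card I) - k)"
      then have A: "A \<in> layer I (int (card I) - k)" "sum (\<lambda>i. - a i) A + (c + sum a I) \<noteq> 0"
        unfolding nonzeros_def by auto
      then show "I - A \<in> nonzeros a c I k"
        using *[OF A(1)] unfolding nonzeros_def mem_Collect_eq t[OF in_layerD(1)[OF A(1) assms]] by simp
    qed
  qed (auto simp: nonzeros_def layer_def)
qed

lemma card_nonzeros:
  fixes a :: "'i \<Rightarrow> 'g::ab_group_add"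
  assumes "finite I" "8 \<le> card I" "1 \<le> k" "k < card I" "nonzeros a c I (int k) \<noteq> {}"
  shows "(real (min k (card I - k)) - 1) * (card I choose k) \<le> card I * card (nonzeros a c I (int k))"
proof (cases "2 * k \<le> card I")
  case True
  then show ?thesis using card_nonzeros_half[of I k a c] assms by (simp add: min_def)
next
  case False
  let ?M = "nonzeros (\<lambda>i. - a i) (c + sum a I) I (int (card I - k))"
  have bij: "bij_betw (\<lambda>A. I - A) (nonzeros a c I (int k)) ?M"
    using nonzeros_complement[OF assms(1), of a c "int k"] assms(4) by (simp add: of_nat_diff)
  then have "card (nonzeros a c I (int k)) = card ?M" "?M \<noteq> {}"
    using assms(5) by (auto simp: bij_betw_same_card bij_betw_def)
  then show ?thesis
    using card_nonzeros_half[of I "card I - k" "\<lambda>i. - a i" "c + sum a I"] assms False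
      binomial_symmetric[of k "card I"] by (simp add: min_def)
qed

section \<open>From sets back to strings\<close>

text \<open>The inverse takes a set to its characteristic function, restricted to
  \<open>{1..n}\<close> because strings are extensional.\<close>

lemma bij_betw_boolean_slice:
  "bij_betw (\<lambda>x. {i \<in> {1..n}. x i = 1}) (boolean_slice n k) (layer {1..n} (int k))"
proof (rule bij_betw_byWitness[where f'="\<lambda>A. \<lambda>i\<in>{1..n}. if i \<in> A then 1 else 0"])
  have "{i \<in> {1..n}. x i \<noteq> 0} = {i \<in> {1..n}. x i = 1}" if "x \<in> boolean_slice n k" for x
  proof -
    have "x i = 0 \<or> x i = 1" if "i \<in> {1..n}" for i
      using \<open>x \<in> boolean_slice n k\<close> that PiE_mem[of x "{1..n}" "\<lambda>_. {0, 1}" i]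
      unfolding boolean_slice_def by simp
    then show ?thesis by force
  qed
  then show "(\<lambda>x. {i \<in> {1..n}. x i = 1}) ` boolean_slice n k \<subseteq> layer {1..n} (int k)"
    unfolding layer_def by (fastforce simp: boolean_slice_def)
  show "\<forall>x\<in>boolean_slice n k. (\<lambda>i\<in>{1..n}. if i \<in> {i \<in> {1..n}. x i = 1} then 1 else 0) = x"
    unfolding boolean_slice_def by (auto simp: PiE_iff fun_eq_iff extensional_def)
  show "\<forall>A\<in>layer {1..n} (int k). {i \<in> {1..n}. (\<lambda>i\<in>{1..n}. if i \<in> A then 1 else 0) i = (1::nat)} = A"
    unfolding layer_def by auto
  show "(\<lambda>A. \<lambda>i\<in>{1..n}. if i \<in> A then 1 else 0) ` layer {1..n} (int k) \<subseteq> boolean_slice n k"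
  proof (rule image_subsetI)
    fix A assume A: "A \<in> layer {1..n} (int k)"
    then have eq: "{i \<in> {1..n}. (\<lambda>i\<in>{1..n}. if i \<in> A then 1 else 0) i \<noteq> (0::nat)} = A"
      unfolding layer_def by (auto split: if_splits)
    show "(\<lambda>i\<in>{1..n}. if i \<in> A then 1 else 0) \<in> boolean_slice n k"
      unfolding boolean_slice_def mem_Collect_eq eq using A unfolding layer_def by auto
  qed
qed

lemma eval_deg1_eq_sum: "eval_deg1 n a c x = sum a {i \<in> {1..n}. x i = 1} + c"
  unfolding eval_deg1_def by (subst sum.inter_filter) auto

theorem theorem6p1:
  fixes a :: "nat \<Rightarrow> 'g::ab_group_add" and c :: 'g and n k :: nat
  assumes "n \<ge> 8"
    and "k \<in> {1..n - 1}"
    and "\<exists>x \<in> boolean_slice n k. eval_deg1 n a c x \<noteq> 0"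
  shows "measure_pmf.prob (pmf_of_set (boolean_slice n k)) {x. eval_deg1 n a c x \<noteq> 0}
           \<ge> (real (min k (n - k)) - 1) / real n"
proof -
  let ?S = "boolean_slice n k" and ?N = "nonzeros a c {1..n} (int k)"
  define supp where "supp x = {i \<in> {1..n}. x i = 1}" for x :: "nat \<Rightarrow> nat"
  have bij: "bij_betw supp ?S (layer {1..n} (int k))"
    using bij_betw_boolean_slice unfolding supp_def .
  have fin: "finite ?S" using bij_betw_finite[OF bij] by simp
  have card_S: "card ?S = n choose k" using bij_betw_same_card[OF bij] by (simp add: card_layer)
  have ne: "?S \<noteq> {}" using assms(3) by auto
  have sub: "?S \<inter> {x. eval_deg1 n a c x \<noteq> 0} \<subseteq> ?S" by simp
  have "supp ` (?S \<inter> {x. eval_deg1 n a c x \<noteq> 0}) = ?N"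
    using bij_betw_imp_surj_on[OF bij, symmetric] unfolding nonzeros_def
    by (auto simp: eval_deg1_eq_sum supp_def)
  from bij_betw_subset[OF bij sub this] have bijN: "bij_betw supp (?S \<inter> {x. eval_deg1 n a c x \<noteq> 0}) ?N" .
  then have card_N: "card (?S \<inter> {x. eval_deg1 n a c x \<noteq> 0}) = card ?N" by (rule bij_betw_same_card)
  have "?N \<noteq> {}" using bijN assms(3) unfolding bij_betw_def by auto
  moreover have "1 \<le> k" "k < n" using assms(1,2) by auto
  ultimately have "(real (min k (n - k)) - 1) * (n choose k) \<le> n * card ?N"
    using card_nonzeros[of "{1..n}" k a c] assms(1) by simp
  moreover have "0 < n choose k" using assms by (auto simp: zero_less_binomial_iff)
  ultimately show ?thesis
    using assms(1) fin ne by (simp add: measure_pmf_of_set card_S card_N field_simps)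
qed

end
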